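(* Let $d\in\mathbb{N}$, $d\geq2$, and let $\beta\in(1,2)$ be the $d$-Bonacci number. Let $\mathcal{P}$ denote the set of non-zero $x\in\mathbb{Z}[\beta]\cap X_S$ such that $T_S^p x=x$ for some $p\geq1$. Then $$\mathcal{P}\cup\{0\}=\Bigl\{\pm\sum_{i=2}^d p_i\beta^{-i} : p_i\in\{0,1\}\Bigr\}.$$
   Context: The $d$-Bonacci number is the Pisot number $\beta\in(1,2)$ satisfying $\beta^d=\beta^{d-1}+\dots+\beta+1$. $X_S=[-\tfrac12,\tfrac\beta2-1)\cup[1-\tfrac\beta2,\tfrac12)$ and $T_S\colon X_S\to X_S$, $T_S(x)=\beta x-\lfloor\beta x-\tfrac12\rfloor$.
   Formalization: The transformation is taken as T_S(x) = βx − ⌊βx + 1/2⌋; with the printed −1/2 inside the floor all values lie in [1/2, 3/2), outside X_S, so there would be no periodic points and the claim would fail. *)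

theory Defs
  imports Complex_Main "HOL-Computational_Algebra.Computational_Algebra"
begin

text \<open>The monic irreducible integer polynomial below is the minimal polynomial of \<open>\<beta>\<close>,
  so its complex roots are the Galois conjugates of \<open>\<beta>\<close>.\<close>

definition is_pisot :: "real \<Rightarrow> bool" where
  "is_pisot \<beta> \<longleftrightarrow> \<beta> > 1 \<and>
     (\<exists>m :: int poly. lead_coeff m = 1 \<and> irreducible m \<and> poly (map_poly of_int m) \<beta> = 0 \<and>
        (\<forall>z :: complex. poly (map_poly of_int m) z = 0 \<and> z \<noteq> of_real \<beta> \<longrightarrow> norm z < 1))"

definition is_dbonacci :: "nat \<Rightarrow> real \<Rightarrow> bool" where
  "is_dbonacci d \<beta> \<longleftrightarrow> is_pisot \<beta> \<and> 1 < \<beta> \<and> \<beta> < 2 \<and> \<beta> ^ d = (\<Sum>i<d. \<beta> ^ i)"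

definition int_adjoin :: "real \<Rightarrow> real set" where
  "int_adjoin \<beta> = {poly (map_poly of_int q) \<beta> | q :: int poly. True}"

definition X_S :: "real \<Rightarrow> real set" where
  "X_S \<beta> = {-1/2 ..< \<beta>/2 - 1} \<union> {1 - \<beta>/2 ..< 1/2}"

text \<open>The shift inside the floor has to be \<open>+1/2\<close>: with \<open>-1/2\<close> all values would lie in
  \<open>[1/2, 3/2)\<close>, outside \<open>X_S \<beta>\<close>. Lemma \<open>T_S_in_X_S\<close> confirms that \<open>T_S \<beta>\<close> is a self-map
  of \<open>X_S \<beta>\<close>.\<close>

definition T_S :: "real \<Rightarrow> real \<Rightarrow> real" where
  "T_S \<beta> x = \<beta> * x - of_int \<lfloor>\<beta> * x + 1/2\<rfloor>"

lemma T_S_in_X_S: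
  assumes \<beta>: "1 < \<beta>" "\<beta> < 2" and x: "x \<in> X_S \<beta>"
  shows "T_S \<beta> x \<in> X_S \<beta>"
proof -
  from x consider (neg) "-1/2 \<le> x" "x < \<beta>/2 - 1" | (pos) "1 - \<beta>/2 \<le> x" "x < 1/2"
    by (auto simp: X_S_def)
  then show ?thesis
  proof cases
    case neg
    have lo: "- \<beta>/2 \<le> \<beta> * x"
      using mult_left_mono[OF neg(1), of \<beta>] \<beta> by simp
    have hi: "\<beta> * x \<le> x"
      using mult_right_mono_neg[of 1 \<beta> x] neg \<beta> by simp
    show ?thesis
    proof (cases "\<beta> * x < -1/2")
      case True
      then have "\<lfloor>\<beta> * x + 1/2\<rfloor> = -1"
        using lo \<beta> by linarith
      then have "T_S \<beta> x = \<beta> * x + 1" by (simp add: T_S_def)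
      then show ?thesis using True lo unfolding X_S_def Un_iff atLeastLessThan_iff by linarith
    next
      case False
      then have "\<lfloor>\<beta> * x + 1/2\<rfloor> = 0"
        using hi neg \<beta> by linarith
      then have "T_S \<beta> x = \<beta> * x" by (simp add: T_S_def)
      then show ?thesis using False hi neg unfolding X_S_def Un_iff atLeastLessThan_iff by linarith
    qed
  next
    case pos
    have hi: "\<beta> * x < \<beta>/2"
      using mult_strict_left_mono[OF pos(2), of \<beta>] \<beta> by simp
    have lo: "x \<le> \<beta> * x"
      using mult_right_mono[of 1 \<beta> x] pos \<beta> by simp
    show ?thesis
    proof (cases "\<beta> * x < 1/2")
      case True
      then have "\<lfloor>\<beta> * x + 1/2\<rfloor> = 0"
        using lo pos \<beta> by linarith
      then have "T_S \<beta> x = \<beta> * x" by (simp add: T_S_def)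
      then show ?thesis using True lo pos unfolding X_S_def Un_iff atLeastLessThan_iff by linarith
    next
      case False
      then have "\<lfloor>\<beta> * x + 1/2\<rfloor> = 1"
        using hi \<beta> by linarith
      then have "T_S \<beta> x = \<beta> * x - 1" by (simp add: T_S_def)
      then show ?thesis using False hi unfolding X_S_def Un_iff atLeastLessThan_iff by linarith
    qed
  qed
qed

definition periodic_points :: "real \<Rightarrow> real set" where
  "periodic_points \<beta> =
     {x \<in> int_adjoin \<beta> \<inter> X_S \<beta>. x \<noteq> 0 \<and> (\<exists>p\<ge>1. (T_S \<beta> ^^ p) x = x)}"

end

theory Submission
  imports Defs
begin

text \<open>
  Let \<open>b\<^sub>n = 1\<close> if \<open>T_S\<^sup>n x < 0\<close> and \<open>b\<^sub>n = 0\<close> otherwise. Non-zero digits of \<open>T_S\<close> alternate in sign, so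
  the \<open>n\<close>-th digit is \<open>b\<^sub>n\<^sub>+\<^sub>1 - b\<^sub>n\<close>. The numbers \<open>\<beta>\<^sup>-\<^sup>1, \<dots>, \<beta>\<^sup>-\<^sup>d\<close> are weights of sum \<open>1\<close>, and the elements
  of \<open>\<int>[\<beta>]\<close> are the deviations \<open>\<Sum>\<^sub>j\<^sub><\<^sub>d F\<^sub>n\<^sub>+\<^sub>j \<beta>\<^bsup>-j-1\<^esup> - F\<^sub>n\<^sub>+\<^sub>d\<close> of integer sequences \<open>F\<close> from their weighted
  mean. An orbit of \<open>T_S\<close> is the sequence of deviations of some \<open>F\<close> with
  \<open>F\<^sub>n\<^sub>+\<^sub>d\<^sub>+\<^sub>1 - 2 F\<^sub>n\<^sub>+\<^sub>d + F\<^sub>n = b\<^sub>n\<^sub>+\<^sub>1 - b\<^sub>n\<close>. An integer sequence without deviation is constant,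
  because a single value below an upper bound keeps all later windows below it, so \<open>F\<close> inherits the
  period of the orbit. With \<open>D\<^sub>n = F\<^sub>n\<^sub>+\<^sub>d - F\<^sub>n\<close> and \<open>A\<^sub>n = F\<^sub>n\<^sub>+\<^sub>d - b\<^sub>n\<close>, summing
  \<open>2 D\<^sub>n (D\<^sub>n - b\<^sub>n) = (A\<^sub>n\<^sub>+\<^sub>1\<^sup>2 - A\<^sub>n\<^sup>2) - (F\<^sub>n\<^sub>+\<^sub>d\<^sup>2 - F\<^sub>n\<^sup>2)\<close> over a period gives \<open>0\<close>, and integrality forces
  \<open>D\<^sub>n \<in> {0, b\<^sub>n}\<close>, hence \<open>D = 0\<close>. So \<open>F\<close> and \<open>b\<close> have period \<open>d\<close> and differ by a constant, and \<open>x\<close> is a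
  deviation of the binary sequence \<open>b\<close>, that is, a signed digit sum.
\<close>

section \<open>Periodic sums and weighted means\<close>

lemma sum_periodic_shift:
  fixes g :: "nat \<Rightarrow> 'a::cancel_comm_monoid_add"
  assumes "\<And>n. g (n + P) = g n"
  shows "(\<Sum>n<P. g (n + k)) = (\<Sum>n<P. g n)"
proof (induction k)
  case (Suc k)
  have "g k + (\<Sum>n<P. g (n + Suc k)) = (\<Sum>n<Suc P. g (n + k))"
    unfolding sum.lessThan_Suc_shift by simp
  also have "\<dots> = g k + (\<Sum>n<P. g (n + k))"
    using assms[of k] by (simp add: add.commute)
  finally show ?case using Suc by simp
qed simp

lemma sum_periodic_nonneg_eq_0D:
  fixes g :: "nat \<Rightarrow> 'a::{cancel_comm_monoid_add, ordered_comm_monoid_add}"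
  assumes "P \<ge> 1" "\<And>n. g (n + P) = g n" "\<And>n. g n \<ge> 0" "(\<Sum>n<P. g n) = 0"
  shows "g n = 0"
proof -
  have "(\<Sum>i<P. g (i + n)) = 0" using sum_periodic_shift[of g P n] assms by simp
  then have "\<forall>i<P. g (i + n) = 0" using assms(3) by (simp add: sum_nonneg_eq_0_iff)
  then show ?thesis using \<open>P \<ge> 1\<close> by auto
qed

lemma sum_lessThan_eq_sum_from_2:
  fixes g :: "nat \<Rightarrow> 'a::comm_monoid_add"
  assumes "d \<ge> 1"
  shows "(\<Sum>j<d. g (Suc j)) = g 1 + (\<Sum>i=2..d. g i)"
proof -
  have "(\<Sum>j<d. g (Suc j)) = (\<Sum>i=Suc 0..d. g i)" by (rule sum.atLeast1_atMost_eq[symmetric])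
  then show ?thesis using assms by (simp add: sum.atLeast_Suc_atMost numeral_2_eq_2)
qed

lemma weighted_mean_less:
  fixes w x :: "'a \<Rightarrow> 'b::linordered_idom"
  assumes "finite I" "\<And>i. i \<in> I \<Longrightarrow> 0 < w i" "sum w I = 1"
    and "\<And>i. i \<in> I \<Longrightarrow> x i \<le> B" "k \<in> I" "x k < B"
  shows "(\<Sum>i\<in>I. w i * x i) < B"
proof -
  have "(\<Sum>i\<in>I. w i * x i) < (\<Sum>i\<in>I. w i * B)"
    using assms by (intro sum_strict_mono_ex1) (auto intro!: mult_left_mono less_imp_le)
  then show ?thesis using assms(3) by (simp flip: sum_distrib_right)
qed

lemma weighted_mean_le:
  fixes w x :: "'a \<Rightarrow> 'b::linordered_idom"
  assumes "\<And>i. i \<in> I \<Longrightarrow> 0 \<le> w i" "sum w I = 1" "\<And>i. i \<in> I \<Longrightarrow> x i \<le> B"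
  shows "(\<Sum>i\<in>I. w i * x i) \<le> B"
proof -
  have "(\<Sum>i\<in>I. w i * x i) \<le> (\<Sum>i\<in>I. w i * B)"
    using assms by (intro sum_mono mult_left_mono) auto
  then show ?thesis using assms(2) by (simp flip: sum_distrib_right)
qed

lemma weighted_mean_ge:
  fixes w x :: "'a \<Rightarrow> 'b::linordered_idom"
  assumes "\<And>i. i \<in> I \<Longrightarrow> 0 \<le> w i" "sum w I = 1" "\<And>i. i \<in> I \<Longrightarrow> B \<le> x i"
  shows "B \<le> (\<Sum>i\<in>I. w i * x i)"
  using weighted_mean_le[of I w "\<lambda>i. - x i" "- B"] assms by (simp add: sum_negf)

locale weighted_mean_recurrence =
  fixes d :: nat and w :: "nat \<Rightarrow> real" and F :: "nat \<Rightarrow> int"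
  assumes weight_pos: "j < d \<Longrightarrow> 0 < w j"
    and sum_weights: "(\<Sum>j<d. w j) = 1"
    and mean: "of_int (F (n + d)) = (\<Sum>j<d. w j * of_int (F (n + j)))"
begin

lemma order_pos: "0 < d"
  using sum_weights by (cases d) auto

lemma bounds:
  obtains A B where "\<And>n. A \<le> F n" "\<And>n. F n \<le> B"
proof -
  define A where "A = Min (F ` {..<d})"
  define B where "B = Max (F ` {..<d})"
  have "A \<le> F n \<and> F n \<le> B" for n
  proof (induction n rule: less_induct)
    case (less n)
    show ?case
    proof (cases "n < d")
      case True
      then show ?thesis by (simp add: A_def B_def)
    next
      case False
      then have "A \<le> F (n - d + j)" "F (n - d + j) \<le> B" if "j < d" for j
        using less that by auto
      then have "real_of_int A \<le> of_int (F (n - d + d))" "of_int (F (n - d + d)) \<le> real_of_int B"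
        unfolding mean using weight_pos sum_weights
        by (intro weighted_mean_ge weighted_mean_le; force intro: less_imp_le)+
      then show ?thesis using False by simp
    qed
  qed
  then show ?thesis using that by blast
qed

lemma less_upper_bound_propagates:
  assumes le: "\<And>n. n \<ge> N \<Longrightarrow> F n \<le> B" and "n \<ge> N" "F n < B"
  shows "F (n + d + i) < B"
proof -
  have less: "F (m + d) < B" if "m \<ge> N" "j < d" "F (m + j) < B" for m j
  proof -
    have "of_int (F (m + d)) < real_of_int B"
      unfolding mean by (rule weighted_mean_less[where k = j])
        (use that le weight_pos sum_weights in auto)
    then show ?thesis by simp
  qed
  show ?thesis
  proof (induction i)
    case 0
    then show ?case using less[of n 0] assms order_pos by simp
  next
    case (Suc i)
    have index_eq: "n + Suc i + (d - 1) = n + d + i" using order_pos by simp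
    have "F (n + Suc i + (d - 1)) < B" unfolding index_eq by (rule Suc)
    then have "F (n + Suc i + d) < B" by (rule less[rotated 2]) (use assms order_pos in auto)
    then show ?case by (simp add: algebra_simps)
  qed
qed

lemma eventually_constant:
  obtains C N where "\<And>n. n \<ge> N \<Longrightarrow> F n = C"
proof -
  obtain A B where A: "\<And>n. A \<le> F n" and B: "\<And>n. F n \<le> B" by (rule bounds) blast
  have "\<exists>C N. \<forall>n\<ge>N. F n = C" if "\<And>n. n \<ge> N \<Longrightarrow> F n \<le> B" for B N
    using that
  proof (induction "nat (B - A)" arbitrary: B N rule: less_induct)
    case less
    show ?case
    proof (cases "\<forall>n\<ge>N. F n = B")
      case False
      then obtain n where n: "n \<ge> N" "F n < B" using less.prems by force
      have "F m \<le> B - 1" if "m \<ge> n + d" for m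
        using less_upper_bound_propagates[OF less.prems n, of "m - (n + d)"] that by simp
      moreover have "nat (B - 1 - A) < nat (B - A)" using A[of n] n by simp
      ultimately show ?thesis using less.hyps[of "B - 1" "n + d"] by blast
    qed blast
  qed
  then show ?thesis using B that by blast
qed

end

section \<open>The difference operator of the d-Bonacci recurrence\<close>

text \<open>The characteristic polynomial is \<open>X\<^bsup>d+1\<^esup> - 2 X\<^sup>d + 1 = (X - 1) (X\<^sup>d - X\<^bsup>d-1\<^esup> - \<dots> - 1)\<close>.\<close>
definition dbonacci_difference :: "nat \<Rightarrow> (nat \<Rightarrow> 'a) \<Rightarrow> nat \<Rightarrow> 'a::comm_ring_1" where
  "dbonacci_difference d F n = F (n + d + 1) - 2 * F (n + d) + F n"

lemma quasi_period_increment_eq_0: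
  fixes F b :: "nat \<Rightarrow> int"
  assumes rec: "\<And>n. dbonacci_difference d F n = b (n + 1) - b n"
    and "d \<noteq> 1" "b P = b 0" and shift: "\<And>n. F (n + P) = F n + K"
  shows "K = 0"
proof -
  define I where "I n = F (n + d) - (\<Sum>j<d. F (n + j)) - b n" for n
  have "I n = I 0" for n
  proof (induction n)
    case (Suc n)
    have "F n + (\<Sum>j<d. F (Suc n + j)) = (\<Sum>j<Suc d. F (n + j))"
      unfolding sum.lessThan_Suc_shift by simp
    then show ?case using rec[of n] Suc by (simp add: I_def dbonacci_difference_def)
  qed simp
  then have "I P = I 0" .
  moreover have "F (P + j) = F j + K" for j using shift[of j] by (simp add: add.commute)
  ultimately have "(int d - 1) * K = 0"
    using \<open>b P = b 0\<close> by (simp add: I_def sum.distrib algebra_simps)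
  then show ?thesis using \<open>d \<noteq> 1\<close> by simp
qed

lemma periodic_binary_dbonacci_difference:
  fixes F b :: "nat \<Rightarrow> int"
  assumes rec: "\<And>n. dbonacci_difference d F n = b (n + 1) - b n"
    and P: "P \<ge> 1" and F_P: "\<And>n. F (n + P) = F n" and b_P: "\<And>n. b (n + P) = b n"
    and binary: "\<And>n. b n \<in> {0, 1}"
  shows "F (n + d) = F n" and "F n - b n = F 0 - b 0"
proof -
  define D where "D n = F (n + d) - F n" for n
  define A where "A n = F (n + d) - b n" for n
  have F_dP: "F (n + P + d) = F (n + d)" for n using F_P[of "n + d"] by (simp add: add_ac)
  have D_P: "D (n + P) = D n" and A_P: "A (n + P) = A n" for n
    by (simp_all add: D_def A_def F_P F_dP b_P)
  have A_Suc: "A (n + 1) = A n + D n" for n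
    using rec[of n] by (simp add: A_def D_def dbonacci_difference_def)
  have energy: "2 * (D n * (D n - b n)) = ((A (n + 1))\<^sup>2 - (A n)\<^sup>2) - ((F (n + d))\<^sup>2 - (F n)\<^sup>2)" for n
    unfolding A_Suc by (simp add: A_def D_def power2_eq_square algebra_simps)
  have "2 * (\<Sum>n<P. D n * (D n - b n)) = 0"
    using sum_periodic_shift[of "\<lambda>n. (A n)\<^sup>2" P 1] sum_periodic_shift[of "\<lambda>n. (F n)\<^sup>2" P d]
    by (simp only: sum_distrib_left energy sum_subtractf) (simp add: A_P F_P)
  then have D_cases: "D n * (D n - b n) = 0" for n
  proof (intro sum_periodic_nonneg_eq_0D[of P "\<lambda>n. D n * (D n - b n)"])
    show "D n * (D n - b n) \<ge> 0" for n
      using binary[of n] by (auto simp: zero_le_mult_iff)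
  qed (use P D_P b_P in auto)
  have "D n \<ge> 0" for n using D_cases[of n] binary[of n] by auto
  moreover have "(\<Sum>n<P. D n) = 0"
    using sum_periodic_shift[of F P d] F_P by (simp add: D_def sum_subtractf)
  ultimately have D_0: "D n = 0" for n
    using sum_periodic_nonneg_eq_0D[of P D] P D_P by blast
  then show "F (n + d) = F n" for n by (simp add: D_def)
  then have "A n = F n - b n" for n by (simp add: A_def)
  moreover have "A n = A 0" by (induction n) (use A_Suc D_0 in auto)
  ultimately show "F n - b n = F 0 - b 0" by simp
qed

fun dbonacci_seq :: "nat \<Rightarrow> (nat \<Rightarrow> 'a) \<Rightarrow> (nat \<Rightarrow> 'a) \<Rightarrow> nat \<Rightarrow> 'a::comm_ring_1" where
  "dbonacci_seq d a c n = (if n \<le> d then a n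
     else 2 * dbonacci_seq d a c (n - 1) - dbonacci_seq d a c (n - 1 - d) + c (n - 1 - d))"

declare dbonacci_seq.simps [simp del]

lemma dbonacci_seq_initial: "n \<le> d \<Longrightarrow> dbonacci_seq d a c n = a n"
  by (simp add: dbonacci_seq.simps)

lemma dbonacci_difference_dbonacci_seq: "dbonacci_difference d (dbonacci_seq d a c) n = c n"
  unfolding dbonacci_difference_def by (subst dbonacci_seq.simps) simp

section \<open>The ring of integer polynomials in \<open>\<beta>\<close> and orbits of \<open>T_S\<close>\<close>

lemma map_poly_of_int_add:
  "map_poly of_int (p + q) = map_poly of_int p + (map_poly of_int q :: 'a::ring_1 poly)"
  by (intro poly_eqI) (simp add: coeff_map_poly)

lemma map_poly_of_int_mult:
  "map_poly of_int (p * q) = map_poly of_int p * (map_poly of_int q :: 'a::comm_ring_1 poly)"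
  by (induction p) (simp_all add: map_poly_of_int_add map_poly_smult map_poly_pCons)

lemma int_adjoin_of_int: "of_int k \<in> int_adjoin \<beta>"
  unfolding int_adjoin_def by (auto intro!: exI[of _ "[:k:]"] simp: map_poly_pCons)

lemma int_adjoin_self: "\<beta> \<in> int_adjoin \<beta>"
  unfolding int_adjoin_def by (auto intro!: exI[of _ "[:0, 1:]"] simp: map_poly_pCons)

lemma int_adjoin_add: "x \<in> int_adjoin \<beta> \<Longrightarrow> y \<in> int_adjoin \<beta> \<Longrightarrow> x + y \<in> int_adjoin \<beta>"
  unfolding int_adjoin_def by clarsimp (metis map_poly_of_int_add poly_add)

lemma int_adjoin_mult: "x \<in> int_adjoin \<beta> \<Longrightarrow> y \<in> int_adjoin \<beta> \<Longrightarrow> x * y \<in> int_adjoin \<beta>"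
  unfolding int_adjoin_def by clarsimp (metis map_poly_of_int_mult poly_mult)

lemma int_adjoin_power: "x \<in> int_adjoin \<beta> \<Longrightarrow> x ^ n \<in> int_adjoin \<beta>"
  by (induction n) (use int_adjoin_of_int[of 1] int_adjoin_mult in auto)

lemma int_adjoin_sum: "(\<And>i. i \<in> A \<Longrightarrow> f i \<in> int_adjoin \<beta>) \<Longrightarrow> sum f A \<in> int_adjoin \<beta>"
  by (induction A rule: infinite_finite_induct)
    (use int_adjoin_of_int[of 0] int_adjoin_add in auto)

lemma T_S_range: "-1/2 \<le> T_S \<beta> x" "T_S \<beta> x < 1/2"
  unfolding T_S_def by linarith+

lemma T_S_eq_sign_change:
  assumes \<beta>: "0 < \<beta>" "\<beta> \<le> 2" and x: "-1/2 \<le> x" "x < 1/2" "x \<noteq> 0"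
  shows "T_S \<beta> x = \<beta> * x - of_int (of_bool (T_S \<beta> x < 0) - of_bool (x < 0))"
proof (cases "x < 0")
  case True
  then have "-1 \<le> \<beta> * x" "\<beta> * x < 0"
    using mult_left_mono[OF x(1), of \<beta>] \<beta> by (auto simp: mult_pos_neg)
  then have "\<lfloor>\<beta> * x + 1/2\<rfloor> = (if \<beta> * x < -1/2 then -1 else 0)" by (auto simp: floor_eq_iff)
  then show ?thesis using True \<open>-1 \<le> \<beta> * x\<close> \<open>\<beta> * x < 0\<close> by (auto simp: T_S_def)
next
  case False
  then have "0 < \<beta> * x" using \<beta> x by simp
  have "\<beta> * x < 1" using mult_strict_left_mono[OF x(2) \<beta>(1)] \<beta> by linarith
  then have "\<lfloor>\<beta> * x + 1/2\<rfloor> = (if \<beta> * x < 1/2 then 0 else 1)"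
    using \<open>0 < \<beta> * x\<close> by (auto simp: floor_eq_iff)
  then show ?thesis using False \<open>0 < \<beta> * x\<close> \<open>\<beta> * x < 1\<close> by (auto simp: T_S_def)
qed

lemma T_S_periodic_orbit_Suc:
  assumes \<beta>: "0 < \<beta>" "\<beta> \<le> 2" and "x \<noteq> 0" "P \<ge> 1" "(T_S \<beta> ^^ P) x = x"
  defines "y \<equiv> \<lambda>n. (T_S \<beta> ^^ n) x"
  shows "y (Suc n) = \<beta> * y n - of_int (of_bool (y (Suc n) < 0) - of_bool (y n < 0))"
proof -
  have y_Suc: "y (Suc n) = T_S \<beta> (y n)" for n by (simp add: y_def)
  obtain Q where "P = Suc Q" using \<open>P \<ge> 1\<close> by (cases P) auto
  then have "y n = (T_S \<beta> ^^ (n + Suc Q)) x" using assms(5) by (simp only: y_def funpow_add o_apply)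
  then have "y n = T_S \<beta> (y (n + Q))" by (simp add: y_def)
  then have range: "-1/2 \<le> y n" "y n < 1/2" by (simp_all only: T_S_range)
  have "y n \<noteq> 0"
  proof
    assume "y n = 0"
    then have "y (n + k) = 0" for k by (induction k) (simp_all add: y_Suc T_S_def)
    moreover have "n + (n * P - n) = n * P" using \<open>P \<ge> 1\<close> by simp
    ultimately have "y (n * P) = 0" by metis
    moreover have "y (n * P) = x"
      using funpow_mod_eq[OF assms(5), of "n * P"] by (simp add: y_def)
    ultimately show False using \<open>x \<noteq> 0\<close> by simp
  qed
  then show ?thesis using T_S_eq_sign_change[OF \<beta> range] by (simp add: y_Suc)
qed

section \<open>Periodic points for d-Bonacci numbers\<close>

locale dbonacci =
  fixes d :: nat and \<beta> :: real
  assumes beta_gt_1: "1 < \<beta>" and beta_power_d: "\<beta> ^ d = (\<Sum>i<d. \<beta> ^ i)"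
begin

lemma d_ge_2: "d \<ge> 2"
proof (rule ccontr)
  assume "\<not> d \<ge> 2"
  then have "d = 0 \<or> d = 1" by linarith
  then show False using beta_gt_1 beta_power_d by auto
qed

lemma inverse_beta_power_d: "1 / \<beta> ^ d = 2 - \<beta>"
proof -
  have "\<beta> ^ d - 1 = (\<beta> - 1) * \<beta> ^ d" using power_diff_1_eq[of \<beta> d] beta_power_d by simp
  then show ?thesis using beta_gt_1 by (simp add: field_simps)
qed

lemma beta_less_2: "\<beta> < 2"
proof -
  have "0 < 1 / \<beta> ^ d" using beta_gt_1 by simp
  then show ?thesis unfolding inverse_beta_power_d by simp
qed

lemma sum_inverse_powers: "(\<Sum>j<d. 1 / \<beta> ^ Suc j) = 1"
proof -
  have "(\<beta> - 1) * (\<Sum>j<d. 1 / \<beta> ^ Suc j) = (\<Sum>j<d. 1 / \<beta> ^ j - 1 / \<beta> ^ Suc j)"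
    unfolding sum_distrib_left using beta_gt_1 by (intro sum.cong) (auto simp: field_simps)
  also have "\<dots> = \<beta> - 1"
    unfolding sum_lessThan_telescope'[of "\<lambda>j. 1 / \<beta> ^ j"] inverse_beta_power_d by simp
  finally show ?thesis using beta_gt_1 by simp
qed

definition deviation :: "(nat \<Rightarrow> int) \<Rightarrow> nat \<Rightarrow> real" where
  "deviation F n = (\<Sum>j<d. of_int (F (n + j) - F (n + d)) / \<beta> ^ Suc j)"

lemma deviation_eq_mean_diff:
  "deviation F n = (\<Sum>j<d. of_int (F (n + j)) / \<beta> ^ Suc j) - of_int (F (n + d))"
proof -
  have "(\<Sum>j<d. of_int (F (n + d)) / \<beta> ^ Suc j) = of_int (F (n + d)) * (\<Sum>j<d. 1 / \<beta> ^ Suc j)"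
    by (simp add: sum_distrib_left)
  then show ?thesis
    by (simp only: deviation_def of_int_diff diff_divide_distrib sum_subtractf sum_inverse_powers)
qed

lemma deviation_Suc:
  "deviation F (Suc n) = \<beta> * deviation F n - of_int (dbonacci_difference d F n)"
proof -
  define h where "h j = of_int (F (n + j)) / \<beta> ^ j" for j
  have "h 0 + (\<Sum>j<d. h (Suc j)) = (\<Sum>j<d. h j) + h d"
    by (simp flip: sum.lessThan_Suc_shift)
  moreover have "h d = of_int (F (n + d)) * (2 - \<beta>)"
    by (simp add: h_def flip: inverse_beta_power_d)
  moreover have "(\<Sum>j<d. h j) = \<beta> * (\<Sum>j<d. of_int (F (n + j)) / \<beta> ^ Suc j)"
    using beta_gt_1 by (simp add: h_def sum_distrib_left)
  ultimately show ?thesis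
    unfolding deviation_eq_mean_diff dbonacci_difference_def by (simp add: h_def algebra_simps)
qed

lemma deviation_diff: "deviation (\<lambda>n. F n - G n) n = deviation F n - deviation G n"
  by (simp add: deviation_eq_mean_diff diff_divide_distrib sum_subtractf)

lemma deviation_shift: "deviation (\<lambda>n. F (n + k)) n = deviation F (n + k)"
  by (simp add: deviation_def add_ac)

lemma deviation_eq_0_imp_constant:
  assumes dev: "\<And>n. deviation F n = 0"
  obtains C where "\<And>n. F n = C"
proof -
  interpret weighted_mean_recurrence d "\<lambda>j. 1 / \<beta> ^ Suc j" F
  proof
    show "(\<Sum>j<d. 1 / \<beta> ^ Suc j) = 1" by (rule sum_inverse_powers)
    show "of_int (F (n + d)) = (\<Sum>j<d. 1 / \<beta> ^ Suc j * real_of_int (F (n + j)))" for n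
      using dev[of n] by (simp add: deviation_eq_mean_diff)
  qed (use beta_gt_1 in simp)
  obtain C N where "\<And>n. n \<ge> N \<Longrightarrow> F n = C" by (rule eventually_constant) blast
  then have "F n = C" for n
  proof (induction N)
    case (Suc N)
    obtain k where k: "d = Suc k" using d_ge_2 by (cases d) auto
    have "deviation F N = of_int (F N - C) / \<beta>"
      using Suc.prems unfolding deviation_def unfolding k sum.lessThan_Suc_shift by simp
    then have "F N = C" using dev[of N] beta_gt_1 by simp
    then show ?case using Suc by (metis le_eq_less_or_eq Suc_le_eq)
  qed simp
  then show ?thesis by (rule that)
qed

lemma deviation_in_int_adjoin: "deviation F n \<in> int_adjoin \<beta>"
proof -
  have "1 / \<beta> ^ Suc j = (of_int 2 + of_int (-1) * \<beta>) * \<beta> ^ (d - Suc j)" if "j < d" for j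
  proof -
    have "\<beta> ^ (d - Suc j) = \<beta> ^ d / \<beta> ^ Suc j" using that beta_gt_1 by (simp add: power_diff)
    moreover have "(2 - \<beta>) * \<beta> ^ d = 1"
      using beta_gt_1 by (simp flip: inverse_beta_power_d)
    ultimately show ?thesis by simp
  qed
  then have "deviation F n = (\<Sum>j<d. of_int (F (n + j) - F (n + d)) *
      ((of_int 2 + of_int (-1) * \<beta>) * \<beta> ^ (d - Suc j)))"
    unfolding deviation_def by (intro sum.cong) (auto simp: divide_inverse)
  also have "\<dots> \<in> int_adjoin \<beta>"
    by (intro int_adjoin_sum int_adjoin_mult int_adjoin_add int_adjoin_power int_adjoin_self
        int_adjoin_of_int)
  finally show ?thesis .
qed

lemma deviation_dbonacci_seq_0: "deviation (dbonacci_seq d F c) 0 = deviation F 0"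
  by (simp add: deviation_def dbonacci_seq_initial)

lemma int_adjoin_imp_deviation:
  assumes "x \<in> int_adjoin \<beta>"
  obtains F where "x = deviation F 0"
proof -
  have "\<exists>F. poly (map_poly of_int q) \<beta> = deviation F 0" for q :: "int poly"
  proof (induction q)
    case 0
    show ?case by (rule exI[of _ "\<lambda>_. 0"]) (simp add: deviation_def)
  next
    case (pCons a q)
    then obtain F where F: "poly (map_poly of_int q) \<beta> = deviation F 0" by blast
    define G where "G = dbonacci_seq d F (\<lambda>_. - a)"
    have "deviation (\<lambda>n. G (n + 1)) 0 = \<beta> * deviation G 0 + of_int a"
      using deviation_Suc[of G 0] dbonacci_difference_dbonacci_seq[of d F "\<lambda>_. - a" 0]
      unfolding deviation_shift by (simp add: G_def)
    then have "poly (map_poly of_int (pCons a q)) \<beta> = deviation (\<lambda>n. G (n + 1)) 0"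
      by (simp add: F G_def deviation_dbonacci_seq_0 map_poly_pCons)
    then show ?case by blast
  qed
  then show ?thesis using assms that unfolding int_adjoin_def by blast
qed

lemma int_adjoin_orbit_eq_deviation:
  assumes "y 0 \<in> int_adjoin \<beta>" "\<And>n. y (Suc n) = \<beta> * y n - of_int (c n)"
  obtains F where "\<And>n. y n = deviation F n" "\<And>n. dbonacci_difference d F n = c n"
proof -
  obtain G where G: "y 0 = deviation G 0" using assms(1) by (rule int_adjoin_imp_deviation)
  define F where "F = dbonacci_seq d G c"
  have rec: "dbonacci_difference d F n = c n" for n
    unfolding F_def by (rule dbonacci_difference_dbonacci_seq)
  have "y n = deviation F n" for n
  proof (induction n)
    case 0
    show ?case by (simp add: G F_def deviation_dbonacci_seq_0)
  next
    case (Suc n)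
    then show ?case unfolding deviation_Suc rec by (simp add: assms(2))
  qed
  then show ?thesis using rec by (rule that)
qed

definition binary_cycle :: "(nat \<Rightarrow> int) \<Rightarrow> bool" where
  "binary_cycle b \<longleftrightarrow> (\<forall>n. b n \<in> {0, 1} \<and> b (n + d) = b n)"

lemma binary_cycleD:
  assumes "binary_cycle b"
  shows "b n \<in> {0, 1}" "b (n + d) = b n"
  using assms by (auto simp: binary_cycle_def)

lemma periodic_deviation_imp_binary_cycle:
  assumes rec: "\<And>n. dbonacci_difference d F n = b (n + 1) - b n"
    and P: "P \<ge> 1" and dev_P: "\<And>n. deviation F (n + P) = deviation F n"
    and b_P: "\<And>n. b (n + P) = b n" and binary: "\<And>n. b n \<in> {0, 1}"
  shows "binary_cycle b" and "deviation F n = deviation b n"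
proof -
  have "deviation (\<lambda>n. F (n + P) - F n) n = 0" for n
    unfolding deviation_diff deviation_shift by (simp add: dev_P)
  then obtain K where "\<And>n. F (n + P) - F n = K" by (rule deviation_eq_0_imp_constant) blast
  then have quasi: "F (n + P) = F n + K" for n by (metis diff_add_cancel add.commute)
  have "K = 0"
    by (rule quasi_period_increment_eq_0[OF rec _ _ quasi]) (use d_ge_2 b_P[of 0] in auto)
  then have F_P: "F (n + P) = F n" for n using quasi by simp
  note F_d = periodic_binary_dbonacci_difference(1)[OF rec P F_P b_P binary]
  note F_b = periodic_binary_dbonacci_difference(2)[OF rec P F_P b_P binary]
  have "b (n + d) = b n" for n using F_d[of n] F_b[of n] F_b[of "n + d"] by simp
  then show "binary_cycle b" using binary by (simp add: binary_cycle_def)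
  have "F k - F m = b k - b m" for k m using F_b[of k] F_b[of m] by simp
  then show "deviation F n = deviation b n" by (simp only: deviation_def)
qed

lemma periodic_point_imp_deviation:
  assumes "x \<in> periodic_points \<beta>"
  obtains b where "binary_cycle b" "x = deviation b 0"
proof -
  obtain P where x: "x \<in> int_adjoin \<beta>" "x \<noteq> 0" and P: "P \<ge> 1" "(T_S \<beta> ^^ P) x = x"
    using assms by (auto simp: periodic_points_def)
  define y where "y n = (T_S \<beta> ^^ n) x" for n
  define b :: "nat \<Rightarrow> int" where "b n = of_bool (y n < 0)" for n
  have y_P: "y (n + P) = y n" for n using P by (simp add: y_def funpow_add)
  have "y (Suc n) = \<beta> * y n - of_int (b (n + 1) - b n)" for n
    using T_S_periodic_orbit_Suc[OF _ _ x(2) P] beta_gt_1 beta_less_2 by (simp add: y_def b_def)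
  then obtain F where F: "\<And>n. y n = deviation F n"
    and rec: "\<And>n. dbonacci_difference d F n = b (n + 1) - b n"
    using int_adjoin_orbit_eq_deviation[of y "\<lambda>n. b (n + 1) - b n"] x(1) by (auto simp: y_def)
  have dev_P: "deviation F (n + P) = deviation F n" for n by (simp add: F[symmetric] y_P)
  have b_P: "b (n + P) = b n" and binary: "b n \<in> {0, 1}" for n by (simp_all add: b_def y_P)
  note cycle = periodic_deviation_imp_binary_cycle[OF rec P(1) dev_P b_P binary]
  have "x = deviation b 0" using F[of 0] cycle(2)[of 0] by (simp add: y_def)
  with cycle(1) show ?thesis by (rule that)
qed

definition digit_sum :: "(nat \<Rightarrow> real) \<Rightarrow> real" where
  "digit_sum p = (\<Sum>i=2..d. p i / \<beta> ^ i)"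

lemma digit_sum_bounds:
  assumes p: "\<And>i. i \<in> {2..d} \<Longrightarrow> p i \<in> {0, 1}"
  shows "digit_sum p = 0 \<or> 2 - \<beta> \<le> digit_sum p" "0 \<le> digit_sum p" "digit_sum p < 1/2"
proof -
  have nonneg: "0 \<le> p i / \<beta> ^ i" if "i \<in> {2..d}" for i
    using p[OF that] beta_gt_1 by auto
  then show "0 \<le> digit_sum p" unfolding digit_sum_def by (rule sum_nonneg)
  have "digit_sum p \<le> (\<Sum>i=2..d. 1 / \<beta> ^ i)" unfolding digit_sum_def
    by (rule sum_mono) (use p beta_gt_1 in \<open>fastforce simp: divide_le_cancel\<close>)
  also have "\<dots> = (\<Sum>j<d. 1 / \<beta> ^ Suc j) - 1 / \<beta>"
    using sum_lessThan_eq_sum_from_2[of d "\<lambda>i. 1 / \<beta> ^ i"] d_ge_2 by simp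
  also have "\<dots> < 1/2" unfolding sum_inverse_powers
    using beta_gt_1 beta_less_2 by (simp add: field_simps)
  finally show "digit_sum p < 1/2" .
  show "digit_sum p = 0 \<or> 2 - \<beta> \<le> digit_sum p"
  proof (cases "\<exists>i\<in>{2..d}. p i = 1")
    case True
    then obtain i where i: "i \<in> {2..d}" "p i = 1" by blast
    have "2 - \<beta> = 1 / \<beta> ^ d" by (simp add: inverse_beta_power_d)
    also have "\<dots> \<le> p i / \<beta> ^ i"
      using i beta_gt_1 by (auto intro!: divide_left_mono power_increasing)
    also have "\<dots> \<le> digit_sum p"
      unfolding digit_sum_def by (rule member_le_sum) (use i nonneg in auto)
    finally show ?thesis by simp
  next
    case False
    then have "p i = 0" if "i \<in> {2..d}" for i using p that by blast
    then show ?thesis by (simp add: digit_sum_def)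
  qed
qed

lemma deviation_eq_sum_from_2:
  assumes "F (n + d) = F n"
  shows "deviation F n = (\<Sum>i=2..d. of_int (F (n + (i - 1)) - F n) / \<beta> ^ i)"
  using sum_lessThan_eq_sum_from_2[of d "\<lambda>i. of_int (F (n + (i - 1)) - F n) / \<beta> ^ i"] d_ge_2 assms
  by (simp add: deviation_def)

lemma deviation_eq_signed_digit_sum:
  assumes "binary_cycle b"
  shows "deviation b n = (1 - 2 * of_int (b n)) * digit_sum (\<lambda>i. of_int \<bar>b (n + (i - 1)) - b n\<bar>)"
proof -
  have sign: "b k - b n = (1 - 2 * b n) * \<bar>b k - b n\<bar>" for k
    using binary_cycleD(1)[OF assms, of n] binary_cycleD(1)[OF assms, of k] by auto
  show ?thesis
    unfolding deviation_eq_sum_from_2[of b n, OF binary_cycleD(2)[OF assms]] digit_sum_def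
      sum_distrib_left by (subst sign) simp
qed

lemma abs_diff_binary_cycle:
  assumes "binary_cycle b"
  shows "real_of_int \<bar>b k - b n\<bar> \<in> {0, 1}"
  using binary_cycleD(1)[OF assms, of n] binary_cycleD(1)[OF assms, of k] by auto

lemma abs_deviation_less:
  assumes "binary_cycle b"
  shows "\<bar>deviation b n\<bar> < 1/2"
proof -
  define v where "v = digit_sum (\<lambda>i. of_int \<bar>b (n + (i - 1)) - b n\<bar>)"
  have "0 \<le> v" "v < 1/2"
    unfolding v_def using abs_diff_binary_cycle[OF assms] by (blast intro: digit_sum_bounds)+
  moreover have "deviation b n = v \<or> deviation b n = - v"
    using deviation_eq_signed_digit_sum[OF assms, of n] binary_cycleD(1)[OF assms, of n]
    unfolding v_def by auto
  ultimately show ?thesis by linarith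
qed

lemma T_S_deviation:
  assumes "binary_cycle b"
  shows "T_S \<beta> (deviation b n) = deviation b (Suc n)"
proof -
  have "dbonacci_difference d b n = b (n + 1) - b n"
    using binary_cycleD(2)[OF assms, of n] binary_cycleD(2)[OF assms, of "n + 1"]
    by (simp add: dbonacci_difference_def)
  then have eq: "\<beta> * deviation b n = deviation b (Suc n) + of_int (b (n + 1) - b n)"
    using deviation_Suc[of b n] by simp
  then have "\<lfloor>\<beta> * deviation b n + 1/2\<rfloor> = b (n + 1) - b n"
    using abs_deviation_less[OF assms, of "Suc n"] by linarith
  then show ?thesis unfolding T_S_def eq by simp
qed

lemma signed_digit_sum_in_X_S:
  assumes "\<sigma> \<in> {1, -1}" "\<And>i. i \<in> {2..d} \<Longrightarrow> p i \<in> {0, 1}" "\<sigma> * digit_sum p \<noteq> 0"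
  shows "\<sigma> * digit_sum p \<in> X_S \<beta>"
proof -
  have "2 - \<beta> \<le> digit_sum p" "digit_sum p < 1/2" using digit_sum_bounds[of p] assms by auto
  then show ?thesis using assms(1) beta_less_2 unfolding X_S_def by auto
qed

lemma deviation_in_periodic_points:
  assumes "binary_cycle b" "deviation b 0 \<noteq> 0"
  shows "deviation b 0 \<in> periodic_points \<beta>"
proof -
  have "(T_S \<beta> ^^ n) (deviation b 0) = deviation b n" for n
    by (induction n) (simp_all add: T_S_deviation assms(1))
  moreover have "deviation b d = deviation b 0"
    using binary_cycleD(2)[OF assms(1)] deviation_shift[of b d 0] by simp
  ultimately have "(T_S \<beta> ^^ d) (deviation b 0) = deviation b 0" by simp
  moreover have "deviation b 0 \<in> X_S \<beta>"
    using assms(2) binary_cycleD(1)[OF assms(1), of 0] abs_diff_binary_cycle[OF assms(1)]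
    unfolding deviation_eq_signed_digit_sum[OF assms(1)]
    by (intro signed_digit_sum_in_X_S) auto
  ultimately show ?thesis
    using assms(2) deviation_in_int_adjoin d_ge_2 unfolding periodic_points_def
    by (auto intro!: exI[of _ d])
qed

lemma signed_digit_sum_imp_deviation:
  assumes \<sigma>: "\<sigma> \<in> {1, -1}" and p: "\<And>i. i \<in> {2..d} \<Longrightarrow> p i \<in> {0, 1}"
  obtains b where "binary_cycle b" "\<sigma> * digit_sum p = deviation b 0"
proof -
  define b :: "nat \<Rightarrow> int" where
    "b n = of_bool ((\<sigma> = -1) \<noteq> (n mod d \<noteq> 0 \<and> p (Suc (n mod d)) = 1))" for n
  have b: "binary_cycle b" by (auto simp: binary_cycle_def b_def)
  have "of_int (b (i - 1) - b 0) = \<sigma> * p i" if "i \<in> {2..d}" for i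
  proof -
    have "(i - 1) mod d = i - 1" "i - 1 \<noteq> 0" "Suc (i - 1) = i" using that by auto
    then show ?thesis using \<sigma> p[OF that] by (auto simp: b_def)
  qed
  then have "deviation b 0 = (\<Sum>i=2..d. \<sigma> * p i / \<beta> ^ i)"
    using deviation_eq_sum_from_2[of b 0] binary_cycleD(2)[OF b, of 0] by simp
  then have "\<sigma> * digit_sum p = deviation b 0" by (simp add: digit_sum_def sum_distrib_left)
  with b show ?thesis by (rule that)
qed

lemma periodic_points_eq_deviations:
  "periodic_points \<beta> \<union> {0} = {deviation b 0 | b. binary_cycle b}"
proof (intro subset_antisym subsetI)
  fix x assume "x \<in> periodic_points \<beta> \<union> {0}"
  then consider (periodic) "x \<in> periodic_points \<beta>" | (zero) "x = 0" by blast
  then show "x \<in> {deviation b 0 | b. binary_cycle b}"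
  proof cases
    case periodic
    then show ?thesis by (rule periodic_point_imp_deviation) blast
  next
    case zero
    then have "binary_cycle (\<lambda>_. 0)" "x = deviation (\<lambda>_. 0) 0"
      by (simp_all add: binary_cycle_def deviation_def)
    then show ?thesis by blast
  qed
qed (use deviation_in_periodic_points in blast)

lemma deviations_eq_signed_digit_sums:
  "{deviation b 0 | b. binary_cycle b} =
    {\<sigma> * digit_sum p | \<sigma> p. \<sigma> \<in> {1, -1} \<and> (\<forall>i\<in>{2..d}. p i \<in> {0, 1})}"
proof (intro subset_antisym subsetI)
  fix x assume "x \<in> {deviation b 0 | b. binary_cycle b}"
  then obtain b where b: "binary_cycle b" and x: "x = deviation b 0" by blast
  have "1 - 2 * of_int (b 0) \<in> {1, -1 :: real}" using binary_cycleD(1)[OF b, of 0] by auto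
  with x show "x \<in> {\<sigma> * digit_sum p | \<sigma> p. \<sigma> \<in> {1, -1} \<and> (\<forall>i\<in>{2..d}. p i \<in> {0, 1})}"
    using deviation_eq_signed_digit_sum[OF b] abs_diff_binary_cycle[OF b] by blast
next
  fix x assume "x \<in> {\<sigma> * digit_sum p | \<sigma> p. \<sigma> \<in> {1, -1} \<and> (\<forall>i\<in>{2..d}. p i \<in> {0, 1})}"
  then obtain \<sigma> p where "\<sigma> \<in> {1, -1}" "\<And>i. i \<in> {2..d} \<Longrightarrow> p i \<in> {0, 1}"
    and x: "x = \<sigma> * digit_sum p"
    by blast
  then obtain b where "binary_cycle b" "\<sigma> * digit_sum p = deviation b 0"
    using signed_digit_sum_imp_deviation by blast
  with x show "x \<in> {deviation b 0 | b. binary_cycle b}" by blast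
qed

end

theorem theorem3:
  fixes d :: nat and \<beta> :: real
  assumes "d \<ge> 2" and "is_dbonacci d \<beta>"
  shows "periodic_points \<beta> \<union> {0} =
    {\<sigma> * (\<Sum>i=2..d. p i / \<beta> ^ i) | (\<sigma> :: real) (p :: nat \<Rightarrow> real).
      \<sigma> \<in> {1, -1} \<and> (\<forall>i\<in>{2..d}. p i \<in> {0, 1})}"
proof -
  interpret dbonacci d \<beta>
    using assms(2) unfolding dbonacci_def is_dbonacci_def by blast
  show ?thesis
    using periodic_points_eq_deviations deviations_eq_signed_digit_sums
    unfolding digit_sum_def by simp
qed

end
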